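(* Let $(G,c)$ be a resistance network with vertex set $G^{0}$, let $\mathcal{H}_{\mathcal{E}}$ be its energy space and let $\mathcal{M}\subseteq\mathcal{H}_{\mathcal{E}}$ be the span of monopoles and dipoles defined in the context. If $u\in\mathcal{H}_{\mathcal{E}}$ and $v\in\mathcal{M}$, then $$\langle u,v\rangle_{\mathcal{E}}=\sum_{x\in G}\overline{u(x)}\,\Delta v(x)+\sum_{x\in\operatorname{bd}G}\overline{u(x)}\,\frac{\partial v}{\partial\mathbf{n}}(x),$$ where the sum over $G$ and the boundary sum over $\operatorname{bd}G$ are the limits along exhaustions of $G$ defined in the context (each of which exists, is finite, and is independent of the exhaustion).
   Context: A resistance network $(G,c)$ is a connected graph with vertex set $G^{0}$ (one writes $x\in G$ for $x\in G^{0}$) together with a symmetric conductance function $c_{xy}=c_{yx}\in[0,\infty)$; adjacency $x\sim y$ means $c_{xy}>0$; $c_{xx}=0$; and $c(x):=\sum_{y\sim x}c_{xy}<\infty$ for each $x$. The function $c(x)$ need not be bounded, and vertices of infinite degree are allowed. Connected means any two vertices are joined by a finite path of edges with positive conductance. A vertex $o\in G^{0}$ is fixed. Laplacian: $(\Delta v)(x):=\sum_{y\sim x}c_{xy}(v(x)-v(y))$ for $v:G^{0}\to\mathbb{C}$. Energy: $\mathcal{E}(u,v):=\frac12\sum_{x,y\in G}c_{xy}(\overline{u(x)}-\overline{u(y)})(v(x)-v(y))$, $\mathcal{E}(u):=\mathcal{E}(u,u)$, $\operatorname{dom}\mathcal{E}:=\{u:G^{0}\to\mathbb{C}: \mathcal{E}(u)<\infty\}$.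 The energy space is the Hilbert space $\mathcal{H}_{\mathcal{E}}:=\operatorname{dom}\mathcal{E}/\mathbb{C}\mathbf{1}$ (functions of finite energy modulo constants) with inner product $\langle u,v\rangle_{\mathcal{E}}:=\mathcal{E}(u,v)$. The formula in the claim is understood for representatives of $u$ and $v$. Energy kernel: $v_x\in\mathcal{H}_{\mathcal{E}}$ is the unique element with $\langle v_x,u\rangle_{\mathcal{E}}=u(x)-u(o)$ for all $u\in\mathcal{H}_{\mathcal{E}}$. $\mathrm{Fin}$ is the $\mathcal{E}$-closure of the span of the Dirac masses $\{\delta_x\}_{x\in G}$, $P_{\mathrm{Fin}}$ is the orthogonal projection of $\mathcal{H}_{\mathcal{E}}$ onto $\mathrm{Fin}$, and $f_x:=P_{\mathrm{Fin}}v_x$. Monopoles: a monopole at $x$ is an element $w_x\in\mathcal{H}_{\mathcal{E}}$ with $\Delta w_x(y)=\delta_{xy}$ (Kronecker delta) for all $y$. If the network supports monopoles, $w_o$ denotes the unique energy-minimizing monopole at $o$, and one sets $w_x^{v}:=v_x+w_o$ and $w_x^{f}:=f_x+w_o$. Then $\mathcal{M}:=\operatorname{span}\{v_x\}_{x\in G}+\operatorname{span}\{w_x^{v},w_x^{f}\}_{x\in G}$ (finite linear combinations); if the network supports no monopoles, $\mathcal{M}=\operatorname{span}\{v_x\}_{x\in G}$. Exhaustion: an increasing sequence $\{G_k\}_{k=1}^\infty$ of finite connected subgraphs with $G_k\subseteq G_{k+1}$ and $G=\bigcup_kG_k$. The notation $\sum_{x\in G}:=\lim_{k\to\infty}\sum_{x\in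 G_k}$ is used when the limit is independent of the choice of exhaustion. Boundary: for a subgraph $H$ of $G$, $\operatorname{bd}H:=\{x\in H:\exists\,y\notin H,\ y\sim x\}$, and for $x\in\operatorname{bd}H$ the normal derivative (relative to $H$) is $\frac{\partial v}{\partial\mathbf{n}}(x):=\sum_{y\in H}c_{xy}(v(x)-v(y))$. The boundary sum is $\sum_{\operatorname{bd}G}:=\lim_{k\to\infty}\sum_{\operatorname{bd}G_k}$, with normal derivatives in the $k$-th term computed relative to $G_k$, whenever this limit is independent of the choice of exhaustion.
   Formalization: The identity is asserted only when Δv vanishes at every vertex of infinite degree (automatic for locally finite networks), since otherwise it can fail, e.g. on an infinite star; existence and exhaustion-independence of both limits are proved without this condition. *)

theory Defs
  imports "HOL-Analysis.Analysis"
begin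

text \<open>
  A network on the vertex set \<^term>\<open>UNIV :: 'v set\<close> is given by its conductance function. Vertices
  of infinite degree are allowed.
\<close>

definition adj :: "('v \<Rightarrow> 'v \<Rightarrow> real) \<Rightarrow> 'v \<Rightarrow> 'v \<Rightarrow> bool" where
  "adj c x y \<longleftrightarrow> c x y > 0"

locale resistance_network =
  fixes c :: "'v \<Rightarrow> 'v \<Rightarrow> real"
  assumes conductance_nonneg: "c x y \<ge> 0"
    and conductance_sym: "c x y = c y x"
    and conductance_diag: "c x x = 0"
    and conductance_summable: "(\<lambda>y. c x y) summable_on {y. adj c x y}"
    and connected: "(adj c)\<^sup>*\<^sup>* x y"

definition laplacian :: "('v \<Rightarrow> 'v \<Rightarrow> real) \<Rightarrow> ('v \<Rightarrow> complex) \<Rightarrow> 'v \<Rightarrow> complex" where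
  "laplacian c v x = (\<Sum>\<^sub>\<infinity>y\<in>{y. adj c x y}. of_real (c x y) * (v x - v y))"

definition energy :: "('v \<Rightarrow> 'v \<Rightarrow> real) \<Rightarrow> ('v \<Rightarrow> complex) \<Rightarrow> ('v \<Rightarrow> complex) \<Rightarrow> complex" where
  "energy c u v =
     1 / 2 * (\<Sum>\<^sub>\<infinity>(x, y)\<in>UNIV. of_real (c x y) * (cnj (u x) - cnj (u y)) * (v x - v y))"

text \<open>The summands of the energy of \<open>u\<close> are nonnegative, so finiteness is summability.\<close>

definition dom_energy :: "('v \<Rightarrow> 'v \<Rightarrow> real) \<Rightarrow> ('v \<Rightarrow> complex) set" where
  "dom_energy c = {u. (\<lambda>(x, y). c x y * (cmod (u x - u y))\<^sup>2) summable_on UNIV}"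

text \<open>
  Functions modulo constants. This type does not depend on the conductances; the energy space of a
  network is the subspace of classes of functions of finite energy.
\<close>

quotient_type 'v potential = "'v \<Rightarrow> complex" / "\<lambda>f g. \<exists>a. \<forall>x. f x = g x + a"
proof (rule equivpI)
  show "reflp (\<lambda>(f :: 'v \<Rightarrow> complex) g. \<exists>a. \<forall>x. f x = g x + a)"
    by (rule reflpI, rule exI[of _ 0]) simp
  show "symp (\<lambda>(f :: 'v \<Rightarrow> complex) g. \<exists>a. \<forall>x. f x = g x + a)"
  proof (rule sympI)
    fix f g :: "'v \<Rightarrow> complex"
    assume "\<exists>a. \<forall>x. f x = g x + a"
    then obtain a where "\<forall>x. f x = g x + a" ..
    then show "\<exists>a. \<forall>x. g x = f x + a"
      by (intro exI[of _ "- a"]) simp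
  qed
  show "transp (\<lambda>(f :: 'v \<Rightarrow> complex) g. \<exists>a. \<forall>x. f x = g x + a)"
  proof (rule transpI)
    fix f g h :: "'v \<Rightarrow> complex"
    assume "\<exists>a. \<forall>x. f x = g x + a" "\<exists>a. \<forall>x. g x = h x + a"
    then obtain a b where "\<forall>x. f x = g x + a" "\<forall>x. g x = h x + b" by blast
    then show "\<exists>a. \<forall>x. f x = h x + a"
      by (intro exI[of _ "a + b"]) simp
  qed
qed

instantiation potential :: (type) ab_group_add
begin

lift_definition zero_potential :: "'a potential" is "\<lambda>_. 0" .

lift_definition plus_potential :: "'a potential \<Rightarrow> 'a potential \<Rightarrow> 'a potential"
  is "\<lambda>f g x. f x + g x"
proof -
  fix f f' g g' :: "'a \<Rightarrow> complex"
  assume "\<exists>a. \<forall>x. f x = f' x + a" "\<exists>a. \<forall>x. g x = g' x + a"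
  then obtain a b where "\<forall>x. f x = f' x + a" "\<forall>x. g x = g' x + b" by blast
  then show "\<exists>a. \<forall>x. f x + g x = f' x + g' x + a"
    by (intro exI[of _ "a + b"]) simp
qed

lift_definition minus_potential :: "'a potential \<Rightarrow> 'a potential \<Rightarrow> 'a potential"
  is "\<lambda>f g x. f x - g x"
proof -
  fix f f' g g' :: "'a \<Rightarrow> complex"
  assume "\<exists>a. \<forall>x. f x = f' x + a" "\<exists>a. \<forall>x. g x = g' x + a"
  then obtain a b where "\<forall>x. f x = f' x + a" "\<forall>x. g x = g' x + b" by blast
  then show "\<exists>a. \<forall>x. f x - g x = f' x - g' x + a"
    by (intro exI[of _ "a - b"]) simp
qed

lift_definition uminus_potential :: "'a potential \<Rightarrow> 'a potential" is "\<lambda>f x. - f x"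
proof -
  fix f f' :: "'a \<Rightarrow> complex"
  assume "\<exists>a. \<forall>x. f x = f' x + a"
  then obtain a where "\<forall>x. f x = f' x + a" ..
  then show "\<exists>a. \<forall>x. - f x = - f' x + a"
    by (intro exI[of _ "- a"]) simp
qed

instance
  by standard (transfer; rule exI[of _ 0]; simp)+

end

lift_definition scale_potential :: "complex \<Rightarrow> 'v potential \<Rightarrow> 'v potential"
  is "\<lambda>r f x. r * f x"
proof -
  fix r :: complex and f f' :: "'v \<Rightarrow> complex"
  assume "\<exists>a. \<forall>x. f x = f' x + a"
  then obtain a where "\<forall>x. f x = f' x + a" ..
  then show "\<exists>a. \<forall>x. r * f x = r * f' x + a"
    by (intro exI[of _ "r * a"]) (simp add: algebra_simps)
qed

interpretation potential: vector_space "scale_potential :: complex \<Rightarrow> 'v potential \<Rightarrow> 'v potential"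
  by standard (transfer; rule exI[of _ 0]; simp add: algebra_simps)+

abbreviation class_of :: "('v \<Rightarrow> complex) \<Rightarrow> 'v potential" where
  "class_of \<equiv> abs_potential"

definition energy_space :: "('v \<Rightarrow> 'v \<Rightarrow> real) \<Rightarrow> 'v potential set" where
  "energy_space c = class_of ` dom_energy c"

lift_definition energy_inner ::
    "('v \<Rightarrow> 'v \<Rightarrow> real) \<Rightarrow> 'v potential \<Rightarrow> 'v potential \<Rightarrow> complex"
  is energy
proof -
  fix c :: "'v \<Rightarrow> 'v \<Rightarrow> real" and f f' g g' :: "'v \<Rightarrow> complex"
  assume "\<exists>a. \<forall>x. f x = f' x + a" "\<exists>a. \<forall>x. g x = g' x + a"
  then obtain a b where "\<forall>x. f x = f' x + a" "\<forall>x. g x = g' x + b" by blast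
  then show "energy c f g = energy c f' g'"
    by (simp add: energy_def)
qed

lift_definition laplacian_class :: "('v \<Rightarrow> 'v \<Rightarrow> real) \<Rightarrow> 'v potential \<Rightarrow> 'v \<Rightarrow> complex"
  is laplacian
proof -
  fix c :: "'v \<Rightarrow> 'v \<Rightarrow> real" and f f' :: "'v \<Rightarrow> complex"
  assume "\<exists>a. \<forall>x. f x = f' x + a"
  then obtain a where "\<forall>x. f x = f' x + a" ..
  then show "laplacian c f = laplacian c f'"
    by (simp add: laplacian_def fun_eq_iff)
qed

lift_definition increment :: "'v potential \<Rightarrow> 'v \<Rightarrow> 'v \<Rightarrow> complex"
  is "\<lambda>u x y. u x - u y"
  by (auto simp: fun_eq_iff)

text \<open>
  The elements \<open>v\<^sub>x\<close>, \<open>f\<^sub>x\<close> and \<open>w\<^sub>o\<close> are described by the properties that characterise them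
  uniquely in the energy space.
\<close>

definition is_energy_kernel ::
    "('v \<Rightarrow> 'v \<Rightarrow> real) \<Rightarrow> 'v \<Rightarrow> 'v \<Rightarrow> 'v potential \<Rightarrow> bool" where
  "is_energy_kernel c orig x v \<longleftrightarrow>
     v \<in> energy_space c \<and> (\<forall>u\<in>energy_space c. energy_inner c v u = increment u x orig)"

definition dirac :: "'v \<Rightarrow> 'v potential" where
  "dirac x = class_of (\<lambda>y. if y = x then 1 else 0)"

definition Fin :: "('v \<Rightarrow> 'v \<Rightarrow> real) \<Rightarrow> 'v potential set" where
  "Fin c = {f \<in> energy_space c.
     \<forall>e>0. \<exists>g\<in>potential.span (range dirac). Re (energy_inner c (f - g) (f - g)) < e}"

definition is_Fin_projection ::
    "('v \<Rightarrow> 'v \<Rightarrow> real) \<Rightarrow> 'v potential \<Rightarrow> 'v potential \<Rightarrow> bool" where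
  "is_Fin_projection c v f \<longleftrightarrow> f \<in> Fin c \<and> (\<forall>g\<in>Fin c. energy_inner c g (v - f) = 0)"

definition is_monopole :: "('v \<Rightarrow> 'v \<Rightarrow> real) \<Rightarrow> 'v \<Rightarrow> 'v potential \<Rightarrow> bool" where
  "is_monopole c x w \<longleftrightarrow>
     w \<in> energy_space c \<and> (\<forall>y. laplacian_class c w y = (if y = x then 1 else 0))"

definition is_minimal_monopole :: "('v \<Rightarrow> 'v \<Rightarrow> real) \<Rightarrow> 'v \<Rightarrow> 'v potential \<Rightarrow> bool" where
  "is_minimal_monopole c x w \<longleftrightarrow> is_monopole c x w \<and>
     (\<forall>w'. is_monopole c x w' \<longrightarrow> Re (energy_inner c w w) \<le> Re (energy_inner c w' w'))"

text \<open>
  Without monopoles the second and third generating sets below are empty, so that the second span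
  is trivial.
\<close>

definition kernel_set :: "('v \<Rightarrow> 'v \<Rightarrow> real) \<Rightarrow> 'v \<Rightarrow> 'v potential set" where
  "kernel_set c orig = {v. \<exists>x. is_energy_kernel c orig x v}"

definition wv_set :: "('v \<Rightarrow> 'v \<Rightarrow> real) \<Rightarrow> 'v \<Rightarrow> 'v potential set" where
  "wv_set c orig =
     {v + w | v w x. is_energy_kernel c orig x v \<and> is_minimal_monopole c orig w}"

definition wf_set :: "('v \<Rightarrow> 'v \<Rightarrow> real) \<Rightarrow> 'v \<Rightarrow> 'v potential set" where
  "wf_set c orig =
     {f + w | f w v x. is_energy_kernel c orig x v \<and> is_Fin_projection c v f \<and>
        is_minimal_monopole c orig w}"

definition monopole_span :: "('v \<Rightarrow> 'v \<Rightarrow> real) \<Rightarrow> 'v \<Rightarrow> 'v potential set" where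
  "monopole_span c orig =
     {a + b | a b. a \<in> potential.span (kernel_set c orig) \<and>
        b \<in> potential.span (wv_set c orig \<union> wf_set c orig)}"

text \<open>
  Subgraphs enter only through their vertex sets, with all edges of positive conductance between
  them: if a subgraph is connected then so is the induced subgraph on its vertices.
\<close>

definition connected_in :: "('v \<Rightarrow> 'v \<Rightarrow> real) \<Rightarrow> 'v set \<Rightarrow> bool" where
  "connected_in c H \<longleftrightarrow>
     (\<forall>x\<in>H. \<forall>y\<in>H. (\<lambda>a b. a \<in> H \<and> b \<in> H \<and> adj c a b)\<^sup>*\<^sup>* x y)"

definition exhaustion :: "('v \<Rightarrow> 'v \<Rightarrow> real) \<Rightarrow> (nat \<Rightarrow> 'v set) \<Rightarrow> bool" where
  "exhaustion c G \<longleftrightarrow>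
     (\<forall>k. finite (G k) \<and> connected_in c (G k) \<and> G k \<subseteq> G (Suc k)) \<and> (\<Union>k. G k) = UNIV"

definition bd :: "('v \<Rightarrow> 'v \<Rightarrow> real) \<Rightarrow> 'v set \<Rightarrow> 'v set" where
  "bd c H = {x \<in> H. \<exists>y. y \<notin> H \<and> adj c y x}"

definition normal_derivative ::
    "('v \<Rightarrow> 'v \<Rightarrow> real) \<Rightarrow> 'v set \<Rightarrow> ('v \<Rightarrow> complex) \<Rightarrow> 'v \<Rightarrow> complex" where
  "normal_derivative c H v x = (\<Sum>y\<in>H. of_real (c x y) * (v x - v y))"

text \<open>
  Sums along exhaustions: the limit exists for every exhaustion and has the same value. The
  existence of an exhaustion is included so that the value is unique.
\<close>

definition has_exhaustion_sum ::
    "('v \<Rightarrow> 'v \<Rightarrow> real) \<Rightarrow> ('v \<Rightarrow> complex) \<Rightarrow> complex \<Rightarrow> bool" where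
  "has_exhaustion_sum c f s \<longleftrightarrow> (\<exists>G. exhaustion c G) \<and>
     (\<forall>G. exhaustion c G \<longrightarrow> (\<lambda>k. \<Sum>x\<in>G k. f x) \<longlonglongrightarrow> s)"

text \<open>Here the summand \<open>F H\<close> may depend on the subgraph \<open>H\<close> whose boundary is summed over.\<close>

definition has_boundary_sum ::
    "('v \<Rightarrow> 'v \<Rightarrow> real) \<Rightarrow> ('v set \<Rightarrow> 'v \<Rightarrow> complex) \<Rightarrow> complex \<Rightarrow> bool" where
  "has_boundary_sum c F s \<longleftrightarrow> (\<exists>G. exhaustion c G) \<and>
     (\<forall>G. exhaustion c G \<longrightarrow> (\<lambda>k. \<Sum>x\<in>bd c (G k). F (G k) x) \<longlonglongrightarrow> s)"

end

theory Submission
  imports Defs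
begin

text \<open>
  On a finite vertex set \<open>H\<close>, summation by parts is exact: the energy of \<open>u\<close> and \<open>v\<close> carried by
  the edges inside \<open>H\<close> is the sum over \<open>H\<close> of \<open>cnj (u x)\<close> times the normal derivative of \<open>v\<close> at
  \<open>x\<close> (\<open>finite_green_identity\<close>). At a vertex of \<open>H\<close> off the boundary the normal derivative is the
  Laplacian. Along an exhaustion the edge energies converge to the full energy, because the defining
  series converges absolutely (\<open>energy_terms_summable\<close>). So a boundary sum exists as soon as the
  interior sum converges.

  The interior sum is eventually constant because the Laplacian of every element of the span of
  monopoles and dipoles is finitely supported (\<open>monopole_span_finite_charge\<close>): pairing with a
  Dirac mass computes the Laplacian (\<open>energy_dirac\<close>), so \<open>v\<^sub>x\<close> has Laplacian \<open>\<delta>\<^sub>x - \<delta>\<^sub>o\<close>, and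
  \<open>f\<^sub>x\<close> has the same one since \<open>v\<^sub>x - f\<^sub>x\<close> is orthogonal to the Dirac masses; the Laplacian of
  \<open>w\<^sub>o\<close> is \<open>\<delta>\<^sub>o\<close>.

  A vertex of infinite degree lies on the boundary of every finite set containing it. Hence the
  limit of the interior sums runs only over the vertices of finite degree, and the two limits add up
  to the energy exactly when the vertices of infinite degree contribute nothing to the sum of
  \<open>cnj (u x)\<close> times the Laplacian of \<open>v\<close> over all \<open>x\<close>.
\<close>

section \<open>Functions of finite energy\<close>

context resistance_network
begin

lemma not_adj_conductance: "\<not> adj c x y \<Longrightarrow> c x y = 0"
  using conductance_nonneg[of x y] by (simp add: adj_def)

lemma adj_sym: "adj c x y \<longleftrightarrow> adj c y x"
  using conductance_sym[of x y] by (simp add: adj_def)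

lemma not_adj_self: "\<not> adj c x x"
  by (simp add: adj_def conductance_diag)

lemma dom_energyD:
  "u \<in> dom_energy c \<Longrightarrow> (\<lambda>p. c (fst p) (snd p) * (cmod (u (fst p) - u (snd p)))\<^sup>2) summable_on UNIV"
  by (simp add: dom_energy_def case_prod_unfold)

lemma dom_energyI:
  assumes "g summable_on UNIV"
    and "\<And>x y. c x y * (cmod (u x - u y))\<^sup>2 \<le> g (x, y)"
  shows "u \<in> dom_energy c"
  unfolding dom_energy_def mem_Collect_eq
  by (rule summable_on_comparison_test[OF assms(1)])
    (auto simp: assms(2) conductance_nonneg)

lemma dom_energy_add:
  assumes u: "u \<in> dom_energy c" and v: "v \<in> dom_energy c"
  shows "(\<lambda>x. u x + v x) \<in> dom_energy c"
proof (rule dom_energyI)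
  let ?e = "\<lambda>w p. c (fst p) (snd p) * (cmod (w (fst p) - w (snd p)))\<^sup>2"
  show "(\<lambda>p. 2 * (?e u p + ?e v p)) summable_on UNIV"
    by (intro summable_on_cmult_right summable_on_add dom_energyD u v)
  fix x y
  have "(cmod (a + b))\<^sup>2 \<le> 2 * ((cmod a)\<^sup>2 + (cmod b)\<^sup>2)" for a b :: complex
  proof -
    have "(cmod (a + b))\<^sup>2 \<le> (cmod a + cmod b)\<^sup>2"
      by (intro power_mono norm_triangle_ineq norm_ge_zero)
    also have "\<dots> \<le> 2 * ((cmod a)\<^sup>2 + (cmod b)\<^sup>2)"
      using sum_squares_bound[of "cmod a" "cmod b"] by (simp add: power2_sum)
    finally show ?thesis .
  qed
  from mult_left_mono[OF this[of "u x - u y" "v x - v y"] conductance_nonneg[of x y]]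
  show "c x y * (cmod (u x + v x - (u y + v y)))\<^sup>2 \<le> 2 * (?e u (x, y) + ?e v (x, y))"
    by (simp add: algebra_simps)
qed

lemma dom_energy_scale:
  assumes u: "u \<in> dom_energy c"
  shows "(\<lambda>x. r * u x) \<in> dom_energy c"
proof (rule dom_energyI)
  show "(\<lambda>p. (cmod r)\<^sup>2 * (c (fst p) (snd p) * (cmod (u (fst p) - u (snd p)))\<^sup>2)) summable_on UNIV"
    by (intro summable_on_cmult_right dom_energyD u)
  show "c x y * (cmod (r * u x - r * u y))\<^sup>2
      \<le> (cmod r)\<^sup>2 * (c (fst (x, y)) (snd (x, y)) * (cmod (u (fst (x, y)) - u (snd (x, y))))\<^sup>2)" for x y
    by (simp flip: right_diff_distrib add: norm_mult power_mult_distrib)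
qed

lemma dom_energy_const: "(\<lambda>_. a) \<in> dom_energy c"
  by (rule dom_energyI[of "\<lambda>_. 0"]) auto

lemma class_of_in_energy_space: "class_of u \<in> energy_space c \<longleftrightarrow> u \<in> dom_energy c"
proof
  assume "class_of u \<in> energy_space c"
  then obtain u' a where u': "u' \<in> dom_energy c" and "\<forall>x. u x = u' x + a"
    by (auto simp: energy_space_def potential.abs_eq_iff)
  then have "u = (\<lambda>x. u' x + a)" by auto
  then show "u \<in> dom_energy c"
    using dom_energy_add[OF u' dom_energy_const] by simp
qed (auto simp: energy_space_def)

text \<open>
  By the elementary inequality \<open>2 a b \<le> a\<^sup>2 + b\<^sup>2\<close> on each edge, the energies of \<open>u\<close> and \<open>v\<close>
  dominate the mixed series.
\<close>

lemma energy_terms_summable: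
  assumes u: "u \<in> dom_energy c" and v: "v \<in> dom_energy c"
  shows "(\<lambda>(x, y). of_real (c x y) * (cnj (u x) - cnj (u y)) * (v x - v y)) summable_on UNIV"
proof -
  let ?e = "\<lambda>w p. c (fst p) (snd p) * (cmod (w (fst p) - w (snd p)))\<^sup>2"
  have "cmod (of_real (c x y) * (cnj (u x) - cnj (u y)) * (v x - v y)) \<le> ?e u (x, y) + ?e v (x, y)"
    for x y
  proof -
    have "cmod (u x - u y) * cmod (v x - v y) \<le> (cmod (u x - u y))\<^sup>2 + (cmod (v x - v y))\<^sup>2"
      using sum_squares_bound[of "cmod (u x - u y)" "cmod (v x - v y)"]
        mult_nonneg_nonneg[OF norm_ge_zero norm_ge_zero, of "u x - u y" "v x - v y"]
      by linarith
    from mult_left_mono[OF this conductance_nonneg[of x y]] show ?thesis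
      using conductance_nonneg[of x y]
      by (simp add: norm_mult distrib_left mult.assoc flip: complex_cnj_diff)
  qed
  then have "(\<lambda>p. cmod ((\<lambda>(x, y). of_real (c x y) * (cnj (u x) - cnj (u y)) * (v x - v y)) p))
      summable_on UNIV"
    by (intro Infinite_Sum.abs_summable_on_comparison_test'[OF summable_on_add[OF dom_energyD[OF u] dom_energyD[OF v]]])
      auto
  then show ?thesis
    by (rule abs_summable_summable)
qed

text \<open>
  Where the difference of \<open>u\<close> across an edge exceeds 1 it is at most its square, so the Laplacian is
  dominated by the total conductance at \<open>x\<close> plus the energy.
\<close>

lemma laplacian_terms_summable:
  assumes u: "u \<in> dom_energy c"
  shows "(\<lambda>y. of_real (c x y) * (u x - u y)) summable_on {y. adj c x y}"
proof -
  have "(\<lambda>p. c (fst p) (snd p) * (cmod (u (fst p) - u (snd p)))\<^sup>2) summable_on Pair x ` {y. adj c x y}"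
    by (rule summable_on_subset[OF dom_energyD[OF u]]) simp
  then have "(\<lambda>y. c x y * (cmod (u x - u y))\<^sup>2) summable_on {y. adj c x y}"
    by (subst (asm) summable_on_reindex) (auto simp: inj_on_def o_def)
  from summable_on_add[OF conductance_summable[of x] this]
  have "(\<lambda>y. cmod (of_real (c x y) * (u x - u y))) summable_on {y. adj c x y}"
  proof (rule Infinite_Sum.abs_summable_on_comparison_test')
    fix y
    have "cmod (u x - u y) \<le> 1 + (cmod (u x - u y))\<^sup>2"
      using sum_squares_bound[of 1 "cmod (u x - u y)"] norm_ge_zero[of "u x - u y"]
      unfolding one_power2 mult_1_right by linarith
    from mult_left_mono[OF this conductance_nonneg[of x y]]
    show "cmod (of_real (c x y) * (u x - u y)) \<le> c x y + c x y * (cmod (u x - u y))\<^sup>2"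
      using conductance_nonneg[of x y] by (simp add: norm_mult distrib_left)
  qed
  then show ?thesis
    by (rule abs_summable_summable)
qed

lemma laplacian_add:
  assumes "u \<in> dom_energy c" "v \<in> dom_energy c"
  shows "laplacian c (\<lambda>x. u x + v x) x = laplacian c u x + laplacian c v x"
  unfolding laplacian_def
  by (subst infsum_add[symmetric])
    (rule laplacian_terms_summable assms infsum_cong | simp add: algebra_simps)+

lemma laplacian_scale: "laplacian c (\<lambda>x. r * u x) x = r * laplacian c u x"
  unfolding laplacian_def infsum_cmult_right'[symmetric] by (simp add: algebra_simps)

section \<open>Dirac masses reproduce the Laplacian\<close>

lemma edges_at_disjoint: "Pair y ` {z. adj c y z} \<inter> (\<lambda>z. (z, y)) ` {z. adj c y z} = {}"
  by (auto simp: not_adj_self)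

text \<open>The edges at \<open>y\<close>, in both orientations, are the only ones across which \<open>\<delta>\<^sub>y\<close> varies.\<close>

lemma edges_at_complement:
  assumes "p \<notin> Pair y ` {z. adj c y z} \<union> (\<lambda>z. (z, y)) ` {z. adj c y z}"
  shows "c (fst p) (snd p) = 0 \<or> (fst p = y \<longleftrightarrow> snd p = y)"
  using assms not_adj_conductance adj_sym by (cases p) (auto simp: image_iff)

lemma dirac_dom_energy: "(\<lambda>x. if x = y then 1 else 0) \<in> dom_energy c"
proof -
  let ?d = "\<lambda>x. if x = y then 1 else 0 :: complex"
  let ?A = "Pair y ` {z. adj c y z}" and ?B = "(\<lambda>z. (z, y)) ` {z. adj c y z}"
  let ?e = "\<lambda>(x, z). c x z * (cmod (?d x - ?d z))\<^sup>2"
  have "(?e \<circ> Pair y) summable_on {z. adj c y z} \<longleftrightarrow> (\<lambda>z. c y z) summable_on {z. adj c y z}"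
    by (rule summable_on_cong) (auto simp: not_adj_self)
  then have "?e summable_on ?A"
    by (subst summable_on_reindex) (auto simp: inj_on_def conductance_summable)
  moreover have "(?e \<circ> (\<lambda>z. (z, y))) summable_on {z. adj c y z}
      \<longleftrightarrow> (\<lambda>z. c y z) summable_on {z. adj c y z}"
    by (rule summable_on_cong) (auto simp: not_adj_self conductance_sym)
  then have "?e summable_on ?B"
    by (subst summable_on_reindex) (auto simp: inj_on_def conductance_summable)
  ultimately have "?e summable_on (?A \<union> ?B)"
    by (rule summable_on_Un_disjoint) (rule edges_at_disjoint)
  also have "?e summable_on (?A \<union> ?B) \<longleftrightarrow> ?e summable_on UNIV"
  proof (rule summable_on_cong_neutral)
    fix p assume "p \<in> UNIV - (?A \<union> ?B)"
    then show "?e p = 0"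
      using edges_at_complement[of p y] by (cases p) auto
  qed auto
  finally show ?thesis
    by (simp add: dom_energy_def)
qed

text \<open>
  Each of the two orientations of the edges at \<open>y\<close> contributes the Laplacian once, and the factor
  one half in the energy compensates.
\<close>

lemma energy_dirac:
  assumes u: "u \<in> dom_energy c"
  shows "energy c (\<lambda>x. if x = y then 1 else 0) u = laplacian c u y"
proof -
  let ?d = "\<lambda>x. if x = y then 1 else 0 :: complex"
  let ?A = "Pair y ` {z. adj c y z}" and ?B = "(\<lambda>z. (z, y)) ` {z. adj c y z}"
  let ?e = "\<lambda>(x, z). of_real (c x z) * (cnj (?d x) - cnj (?d z)) * (u x - u z)"
  have summable: "?e summable_on S" for S
    by (rule summable_on_subset[OF energy_terms_summable[OF dirac_dom_energy u]]) simp
  have A: "infsum ?e ?A = laplacian c u y"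
    unfolding laplacian_def
    by (subst infsum_reindex) (auto simp: inj_on_def o_def not_adj_self intro!: infsum_cong)
  have B: "infsum ?e ?B = laplacian c u y"
    unfolding laplacian_def
    by (subst infsum_reindex)
      (auto simp: inj_on_def o_def not_adj_self conductance_sym algebra_simps intro!: infsum_cong)
  have "infsum ?e UNIV = infsum ?e (?A \<union> ?B)"
  proof (rule infsum_cong_neutral)
    fix p assume "p \<in> UNIV - (?A \<union> ?B)"
    then show "?e p = 0"
      using edges_at_complement[of p y] by (cases p) auto
  qed auto
  also have "\<dots> = infsum ?e ?A + infsum ?e ?B"
    by (intro infsum_Un_disjoint summable edges_at_disjoint)
  finally show ?thesis
    by (simp add: energy_def A B)
qed

section \<open>The Laplacian on the span of monopoles and dipoles\<close>

lemma energy_spaceE: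
  assumes "p \<in> energy_space c"
  obtains u where "u \<in> dom_energy c" "p = class_of u"
  using assms by (auto simp: energy_space_def)

lemma energy_space_subspace: "potential.subspace (energy_space c)"
  unfolding potential.subspace_def
proof (intro conjI ballI allI)
  show "0 \<in> energy_space c"
    by (simp add: zero_potential_def class_of_in_energy_space dom_energy_const)
  show "p + q \<in> energy_space c" if "p \<in> energy_space c" "q \<in> energy_space c" for p q
    using that
    by (elim energy_spaceE) (simp add: plus_potential.abs_eq class_of_in_energy_space dom_energy_add)
  show "scale_potential r p \<in> energy_space c" if "p \<in> energy_space c" for r p
    using that
    by (elim energy_spaceE) (simp add: scale_potential.abs_eq class_of_in_energy_space dom_energy_scale)
qed

lemma laplacian_class_add:
  assumes "p \<in> energy_space c" "q \<in> energy_space c"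
  shows "laplacian_class c (p + q) x = laplacian_class c p x + laplacian_class c q x"
  using assms by (auto elim!: energy_spaceE simp: plus_potential.abs_eq laplacian_class.abs_eq laplacian_add)

lemma laplacian_class_scale:
  assumes "p \<in> energy_space c"
  shows "laplacian_class c (scale_potential r p) x = r * laplacian_class c p x"
  using assms by (auto elim!: energy_spaceE simp: scale_potential.abs_eq laplacian_class.abs_eq laplacian_scale)

lemma laplacian_class_zero: "laplacian_class c 0 x = 0"
  by (simp add: zero_potential_def laplacian_class.abs_eq laplacian_def)

lemma dirac_in_energy_space: "dirac y \<in> energy_space c"
  by (simp add: dirac_def class_of_in_energy_space dirac_dom_energy)

lemma energy_inner_dirac:
  assumes "p \<in> energy_space c"
  shows "energy_inner c (dirac y) p = laplacian_class c p y"
  using assms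
  by (auto elim!: energy_spaceE simp: dirac_def energy_inner.abs_eq laplacian_class.abs_eq energy_dirac)

lemma energy_inner_cnj: "energy_inner c p q = cnj (energy_inner c q p)"
proof (transfer fixing: c)
  show "energy c f g = cnj (energy c g f)" for f g
    unfolding energy_def
    by (auto simp: infsum_cnj[symmetric] case_prod_unfold mult.commute mult.left_commute
        simp del: infsum_cnj intro!: infsum_cong)
qed

lemma energy_inner_zero: "energy_inner c 0 p = 0"
  by (transfer fixing: c) (simp add: energy_def case_prod_unfold)

lemma dirac_in_Fin: "dirac y \<in> Fin c"
  unfolding Fin_def
  by (auto simp: dirac_in_energy_space energy_inner_zero intro!: bexI[of _ "dirac y"] potential.span_base)

lemma energy_kernel_laplacian:
  assumes "is_energy_kernel c orig x v"
  shows "laplacian_class c v y = (if x = y then 1 else 0) - (if orig = y then 1 else 0)"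
proof -
  have "laplacian_class c v y = cnj (energy_inner c v (dirac y))"
    using assms energy_inner_cnj[of "dirac y" v] by (simp add: is_energy_kernel_def energy_inner_dirac)
  also have "energy_inner c v (dirac y) = increment (dirac y) x orig"
    using assms dirac_in_energy_space by (simp add: is_energy_kernel_def)
  finally show ?thesis
    by (simp add: dirac_def increment.abs_eq)
qed

text \<open>
  The complement of the closed span of the Dirac masses consists of harmonic functions, so the
  projection onto that span does not change the Laplacian.
\<close>

lemma Fin_projection_laplacian:
  assumes v: "v \<in> energy_space c" and "is_Fin_projection c v f"
  shows "laplacian_class c f y = laplacian_class c v y"
proof -
  have f: "f \<in> energy_space c" and orth: "energy_inner c (dirac y) (v - f) = 0"
    using assms(2) dirac_in_Fin by (auto simp: is_Fin_projection_def Fin_def)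
  have d: "v - f \<in> energy_space c"
    by (rule potential.subspace_diff[OF energy_space_subspace v f])
  have "laplacian_class c v y = laplacian_class c (v - f) y + laplacian_class c f y"
    using laplacian_class_add[OF d f] by simp
  then show ?thesis
    using orth energy_inner_dirac[OF d] by simp
qed

definition finite_charge :: "'v potential set" where
  "finite_charge = {p \<in> energy_space c. finite {y. laplacian_class c p y \<noteq> 0}}"

lemma finite_charge_subspace: "potential.subspace finite_charge"
  unfolding potential.subspace_def
proof (intro conjI ballI allI)
  show "0 \<in> finite_charge"
    using potential.subspace_0[OF energy_space_subspace] by (simp add: finite_charge_def laplacian_class_zero)
next
  fix p q assume p: "p \<in> finite_charge" and q: "q \<in> finite_charge"
  have "{y. laplacian_class c (p + q) y \<noteq> 0}
      \<subseteq> {y. laplacian_class c p y \<noteq> 0} \<union> {y. laplacian_class c q y \<noteq> 0}"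
    using p q by (auto simp: finite_charge_def laplacian_class_add)
  moreover have "finite ({y. laplacian_class c p y \<noteq> 0} \<union> {y. laplacian_class c q y \<noteq> 0})"
    using p q by (simp add: finite_charge_def)
  ultimately show "p + q \<in> finite_charge"
    using p q potential.subspace_add[OF energy_space_subspace, of p q]
    by (auto simp: finite_charge_def dest: finite_subset)
next
  fix r p assume p: "p \<in> finite_charge"
  then show "scale_potential r p \<in> finite_charge"
    using potential.subspace_scale[OF energy_space_subspace, of p r]
    by (auto simp: finite_charge_def laplacian_class_scale)
qed

lemma energy_kernel_finite_charge:
  assumes v: "is_energy_kernel c orig x v"
  shows "v \<in> finite_charge"
proof -
  have "finite {y. laplacian_class c v y \<noteq> 0}"
    by (rule finite_subset[of _ "{x, orig}"]) (auto simp: energy_kernel_laplacian[OF v])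
  then show ?thesis
    using v by (simp add: finite_charge_def is_energy_kernel_def)
qed

lemma Fin_projection_finite_charge:
  assumes v: "is_energy_kernel c orig x v" and f: "is_Fin_projection c v f"
  shows "f \<in> finite_charge"
proof -
  have "v \<in> energy_space c" "f \<in> energy_space c"
    using v f by (auto simp: is_energy_kernel_def is_Fin_projection_def Fin_def)
  then show ?thesis
    using energy_kernel_finite_charge[OF v] Fin_projection_laplacian[OF _ f]
    by (simp add: finite_charge_def)
qed

lemma monopole_finite_charge: "is_monopole c x w \<Longrightarrow> w \<in> finite_charge"
  by (auto simp: finite_charge_def is_monopole_def)

lemma monopole_span_finite_charge: "monopole_span c orig \<subseteq> finite_charge"
proof -
  have "potential.span (kernel_set c orig) \<subseteq> finite_charge"
    by (rule potential.span_minimal[OF _ finite_charge_subspace])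
      (auto simp: kernel_set_def energy_kernel_finite_charge)
  moreover have "potential.span (wv_set c orig \<union> wf_set c orig) \<subseteq> finite_charge"
    by (rule potential.span_minimal[OF _ finite_charge_subspace])
      (auto simp: wv_set_def wf_set_def is_minimal_monopole_def
        intro!: potential.subspace_add[OF finite_charge_subspace]
        intro: energy_kernel_finite_charge Fin_projection_finite_charge monopole_finite_charge)
  ultimately show ?thesis
    by (auto simp: monopole_span_def intro!: potential.subspace_add[OF finite_charge_subspace])
qed

section \<open>Exhaustions\<close>

text \<open>
  Since the conductances at a vertex are summable, each vertex has countably many neighbours; by
  connectedness the whole network is countable.
\<close>

lemma countable_vertices: "countable (UNIV :: 'v set)"
proof -
  let ?R = "{(x, y). adj c x y}"
  have nbrs: "countable {y. adj c x y}" for x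
    using summable_countable_real[OF conductance_summable[of x]]
    by (rule countable_subset[rotated]) (auto simp: adj_def)
  \<comment> \<open>Any vertex serves as the starting point, since all others can be reached from it.\<close>
  have "countable (?R\<^sup>* `` {undefined})"
  proof (rule countable_rtrancl)
    fix Y :: "'v set" assume "countable Y"
    then have "countable (\<Union>x\<in>Y. {y. adj c x y})"
      using nbrs by blast
    also have "(\<Union>x\<in>Y. {y. adj c x y}) = ?R `` Y" by auto
    finally show "countable (?R `` Y)" .
  qed simp
  also have "?R\<^sup>* `` {undefined} = UNIV"
    using connected[of undefined] by (auto simp: rtranclp_rtrancl_eq[symmetric])
  finally show ?thesis .
qed

lemma connected_in_Un:
  assumes "connected_in c A" "connected_in c B" "z \<in> A" "z \<in> B"
  shows "connected_in c (A \<union> B)"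
  unfolding connected_in_def
proof (intro ballI)
  let ?R = "\<lambda>H a b. a \<in> H \<and> b \<in> H \<and> adj c a b"
  have mono: "(?R H)\<^sup>*\<^sup>* a b \<Longrightarrow> (?R (A \<union> B))\<^sup>*\<^sup>* a b" if "H \<subseteq> A \<union> B" for H a b
    using that by (elim rtranclp_mono[THEN predicate2D, rotated]) auto
  fix x y assume "x \<in> A \<union> B" "y \<in> A \<union> B"
  then have "(?R (A \<union> B))\<^sup>*\<^sup>* x z" "(?R (A \<union> B))\<^sup>*\<^sup>* z y"
    using assms mono[of A] mono[of B] unfolding connected_in_def by blast+
  then show "(?R (A \<union> B))\<^sup>*\<^sup>* x y" by simp
qed

lemma finite_connected_superset:
  assumes "(adj c)\<^sup>*\<^sup>* x y"
  shows "\<exists>H. finite H \<and> connected_in c H \<and> x \<in> H \<and> y \<in> H"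
  using assms
proof induction
  case base
  show ?case by (rule exI[of _ "{x}"]) (auto simp: connected_in_def)
next
  case (step y z)
  then obtain H where H: "finite H" "connected_in c H" "x \<in> H" "y \<in> H" by blast
  have "connected_in c {y, z}"
    using step.hyps(2) adj_sym[of y z] unfolding connected_in_def
    by (auto intro!: r_into_rtranclp)
  then have "connected_in c (H \<union> {y, z})"
    using H by (intro connected_in_Un[of _ _ y]) auto
  then show ?case
    using H by (intro exI[of _ "H \<union> {y, z}"]) auto
qed

text \<open>
  Every vertex lies with a fixed vertex \<open>z\<close> in a finite connected set. Because all these sets share
  \<open>z\<close>, their unions stay connected, and the unions of the first few along an enumeration of the
  vertices exhaust the network.
\<close>

lemma exhaustion_exists: "\<exists>G. exhaustion c G"
proof -
  fix z :: 'v
  have "\<forall>x. \<exists>H. finite H \<and> connected_in c H \<and> z \<in> H \<and> x \<in> H"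
    using finite_connected_superset[OF connected] by blast
  then obtain P where P: "\<And>x. finite (P x) \<and> connected_in c (P x) \<and> z \<in> P x \<and> x \<in> P x"
    by metis
  define e where "e = from_nat_into (UNIV :: 'v set)"
  define G where "G k = (\<Union>i\<le>k. P (e i))" for k :: nat
  have G_Suc: "G (Suc k) = G k \<union> P (e (Suc k))" for k
    by (auto simp: G_def atMost_Suc)
  have "finite (G k) \<and> connected_in c (G k) \<and> z \<in> G k" for k
  proof (induction k)
    case 0
    show ?case using P by (simp add: G_def)
  next
    case (Suc k)
    then show ?case
      using P[of "e (Suc k)"] connected_in_Un[of "G k" "P (e (Suc k))" z] by (simp add: G_Suc)
  qed
  moreover have "x \<in> (\<Union>k. G k)" for x
  proof -
    obtain i where "e i = x"
      using from_nat_into_surj[OF countable_vertices, of x] by (auto simp: e_def)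
    then show ?thesis
      using P[of x] by (auto simp: G_def)
  qed
  ultimately have "exhaustion c G"
    by (auto simp: exhaustion_def G_Suc)
  then show ?thesis by blast
qed

end

lemma exhaustion_filterlim:
  assumes "exhaustion c G"
  shows "filterlim G (finite_subsets_at_top UNIV) sequentially"
proof -
  have G: "finite (G k)" "G k \<subseteq> G (Suc k)" "(\<Union>k. G k) = UNIV" for k
    using assms by (auto simp: exhaustion_def)
  have mono: "mono G"
    by (rule mono_iff_le_Suc[THEN iffD2]) (simp add: G)
  have "\<forall>\<^sub>F k in sequentially. x \<in> G k" for x
  proof -
    obtain i where "x \<in> G i" using G(3) by blast
    then show ?thesis
      using mono by (auto simp: eventually_sequentially mono_def intro!: exI[of _ i])
  qed
  then have "\<forall>\<^sub>F k in sequentially. X \<subseteq> G k" if "finite X" for X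
    using that by (simp add: subset_eq eventually_ball_finite_distrib)
  then show ?thesis
    by (auto simp: filterlim_finite_subsets_at_top G)
qed

lemma exhaustion_eventually_subset:
  assumes "exhaustion c G" "finite X"
  shows "\<forall>\<^sub>F k in sequentially. finite (G k) \<and> X \<subseteq> G k"
  using exhaustion_filterlim[OF assms(1)] assms(2) by (auto simp: filterlim_finite_subsets_at_top)

lemma exhaustion_pairs_filterlim:
  assumes "exhaustion c G"
  shows "filterlim (\<lambda>k. G k \<times> G k) (finite_subsets_at_top UNIV) sequentially"
  unfolding filterlim_finite_subsets_at_top
proof (intro allI impI)
  fix X :: "('a \<times> 'a) set" assume X: "finite X \<and> X \<subseteq> UNIV"
  then have "finite (fst ` X \<union> snd ` X)" by simp
  from exhaustion_eventually_subset[OF assms this]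
  show "\<forall>\<^sub>F k in sequentially. finite (G k \<times> G k) \<and> X \<subseteq> G k \<times> G k \<and> G k \<times> G k \<subseteq> UNIV"
    by eventually_elim (auto simp: image_subset_iff mem_Times_iff)
qed

section \<open>Summation by parts\<close>

context resistance_network
begin

text \<open>
  The half in the energy accounts for each edge being counted in both orientations: exchanging
  \<open>x\<close> and \<open>y\<close> turns the terms with \<open>cnj (u y)\<close> into those with \<open>cnj (u x)\<close>.
\<close>

lemma finite_green_identity:
  assumes "finite H"
  shows "1 / 2 * (\<Sum>(x, y)\<in>H \<times> H. of_real (c x y) * (cnj (u x) - cnj (u y)) * (v x - v y))
    = (\<Sum>x\<in>H. cnj (u x) * normal_derivative c H v x)"
proof -
  let ?t = "\<lambda>w x y. of_real (c x y) * cnj (u w) * (v x - v y)"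
  have "(\<Sum>x\<in>H. \<Sum>y\<in>H. ?t y x y) = (\<Sum>x\<in>H. \<Sum>y\<in>H. ?t x y x)"
    by (rule sum.swap)
  also have "\<dots> = - (\<Sum>x\<in>H. \<Sum>y\<in>H. ?t x x y)"
    by (simp add: conductance_sym algebra_simps flip: sum_negf)
  finally have swap: "(\<Sum>x\<in>H. \<Sum>y\<in>H. ?t y x y) = - (\<Sum>x\<in>H. \<Sum>y\<in>H. ?t x x y)" .
  have "(\<Sum>(x, y)\<in>H \<times> H. of_real (c x y) * (cnj (u x) - cnj (u y)) * (v x - v y))
      = (\<Sum>x\<in>H. \<Sum>y\<in>H. ?t x x y - ?t y x y)"
    by (simp add: sum.cartesian_product[symmetric] algebra_simps)
  also have "\<dots> = 2 * (\<Sum>x\<in>H. \<Sum>y\<in>H. ?t x x y)"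
    unfolding sum_subtractf swap by simp
  also have "(\<Sum>x\<in>H. \<Sum>y\<in>H. ?t x x y) = (\<Sum>x\<in>H. cnj (u x) * normal_derivative c H v x)"
    by (simp add: normal_derivative_def sum_distrib_left mult_ac)
  finally show ?thesis by simp
qed

lemma normal_derivative_interior:
  assumes "finite H" "x \<in> H" "x \<notin> bd c H"
  shows "normal_derivative c H v x = laplacian c v x"
proof -
  have "{y. adj c x y} \<subseteq> H"
    using assms(2,3) adj_sym by (auto simp: bd_def)
  then have "laplacian c v x = (\<Sum>\<^sub>\<infinity>y\<in>H. of_real (c x y) * (v x - v y))"
    unfolding laplacian_def by (intro infsum_cong_neutral) (auto simp: not_adj_conductance)
  then show ?thesis
    using assms(1) by (simp add: normal_derivative_def)
qed

lemma bd_infinite_degree: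
  assumes "finite H" "x \<in> H" "infinite {y. adj c x y}"
  shows "x \<in> bd c H"
proof -
  have "\<not> {y. adj c x y} \<subseteq> H"
    using assms finite_subset by blast
  then show ?thesis
    using assms(2) adj_sym by (auto simp: bd_def)
qed

text \<open>
  The edges inside \<open>G k\<close> form an exhausting sequence of finite sets of pairs, along which an
  unconditionally convergent series tends to its sum.
\<close>

lemma edge_energy_tendsto:
  assumes "u \<in> dom_energy c" "v \<in> dom_energy c" "exhaustion c G"
  shows "(\<lambda>k. \<Sum>x\<in>G k. cnj (u x) * normal_derivative c (G k) v x) \<longlonglongrightarrow> energy c u v"
proof -
  let ?e = "\<lambda>(x, y). of_real (c x y) * (cnj (u x) - cnj (u y)) * (v x - v y)"
  have "(sum ?e \<longlongrightarrow> infsum ?e UNIV) (finite_subsets_at_top UNIV)"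
    using energy_terms_summable[OF assms(1,2)] by (simp add: has_sum_def[symmetric])
  then have "(\<lambda>k. sum ?e (G k \<times> G k)) \<longlonglongrightarrow> infsum ?e UNIV"
    by (rule filterlim_compose) (rule exhaustion_pairs_filterlim[OF assms(3)])
  then have "(\<lambda>k. 1 / 2 * sum ?e (G k \<times> G k)) \<longlonglongrightarrow> energy c u v"
    unfolding energy_def by (intro tendsto_intros)
  moreover have "finite (G k)" for k
    using assms(3) by (simp add: exhaustion_def)
  ultimately show ?thesis
    by (simp only: finite_green_identity)
qed

text \<open>
  Once \<open>G k\<close> contains the finitely many vertices of finite degree with nonzero Laplacian and all
  their neighbours, these vertices are interior, while a vertex of infinite degree never is. From
  then on the sum is constant.
\<close>

lemma interior_sum_tendsto:
  assumes D: "finite {x. laplacian c v x \<noteq> 0}" and G: "exhaustion c G"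
  shows "(\<lambda>k. \<Sum>x\<in>G k - bd c (G k). cnj (u x) * laplacian c v x) \<longlonglongrightarrow>
    (\<Sum>x\<in>{x. laplacian c v x \<noteq> 0 \<and> finite {y. adj c x y}}. cnj (u x) * laplacian c v x)"
proof (rule tendsto_eventually)
  let ?D = "{x. laplacian c v x \<noteq> 0 \<and> finite {y. adj c x y}}"
  let ?X = "?D \<union> (\<Union>x\<in>?D. {y. adj c x y})"
  have "finite ?D"
    by (rule finite_subset[OF _ D]) auto
  then have "finite ?X" by auto
  from exhaustion_eventually_subset[OF G this]
  show "\<forall>\<^sub>F k in sequentially. (\<Sum>x\<in>G k - bd c (G k). cnj (u x) * laplacian c v x)
      = (\<Sum>x\<in>?D. cnj (u x) * laplacian c v x)"
  proof eventually_elim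
    case (elim k)
    have sub: "?D \<subseteq> G k - bd c (G k)"
      using elim adj_sym by (auto simp: bd_def)
    have zero: "\<forall>x\<in>G k - bd c (G k) - ?D. cnj (u x) * laplacian c v x = 0"
      using elim bd_infinite_degree by fastforce
    have "finite (G k - bd c (G k))"
      using elim by blast
    then show ?case
      by (rule sum.mono_neutral_right[OF _ sub zero])
  qed
qed

lemma boundary_sum_tendsto:
  assumes u: "u \<in> dom_energy c" and v: "v \<in> dom_energy c"
    and D: "finite {x. laplacian c v x \<noteq> 0}" and G: "exhaustion c G"
  shows "(\<lambda>k. \<Sum>x\<in>bd c (G k). cnj (u x) * normal_derivative c (G k) v x) \<longlonglongrightarrow> energy c u v -
    (\<Sum>x\<in>{x. laplacian c v x \<noteq> 0 \<and> finite {y. adj c x y}}. cnj (u x) * laplacian c v x)"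
proof -
  have "(\<Sum>x\<in>bd c (G k). cnj (u x) * normal_derivative c (G k) v x) =
      (\<Sum>x\<in>G k. cnj (u x) * normal_derivative c (G k) v x) -
      (\<Sum>x\<in>G k - bd c (G k). cnj (u x) * laplacian c v x)" for k
  proof -
    have fin: "finite (G k)" and sub: "bd c (G k) \<subseteq> G k"
      using G by (auto simp: exhaustion_def bd_def)
    have "(\<Sum>x\<in>G k - bd c (G k). cnj (u x) * laplacian c v x) =
        (\<Sum>x\<in>G k - bd c (G k). cnj (u x) * normal_derivative c (G k) v x)"
      using fin by (intro sum.cong) (auto simp: normal_derivative_interior)
    then show ?thesis
      using sum.subset_diff[OF sub fin, of "\<lambda>x. cnj (u x) * normal_derivative c (G k) v x"] by simp
  qed
  then show ?thesis
    using tendsto_diff[OF edge_energy_tendsto[OF u v G] interior_sum_tendsto[OF D G]] by simp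
qed

end

theorem theorem3p3:
  fixes c :: "'v \<Rightarrow> 'v \<Rightarrow> real" and orig :: 'v and u v :: "'v \<Rightarrow> complex"
  assumes "resistance_network c"
    and "class_of u \<in> energy_space c"
    and "class_of v \<in> monopole_span c orig"
  shows "\<exists>S B.
    has_exhaustion_sum c (\<lambda>x. cnj (u x) * laplacian c v x) S \<and>
    has_boundary_sum c (\<lambda>H x. cnj (u x) * normal_derivative c H v x) B \<and>
    ((\<forall>x. infinite {y. adj c x y} \<longrightarrow> laplacian c v x = 0) \<longrightarrow>
       energy_inner c (class_of u) (class_of v) = S + B)"
proof -
  interpret resistance_network c by fact
  let ?D = "{x. laplacian c v x \<noteq> 0}"
  let ?F = "{x. laplacian c v x \<noteq> 0 \<and> finite {y. adj c x y}}"
  let ?S = "\<Sum>x\<in>?D. cnj (u x) * laplacian c v x"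
  let ?B = "energy c u v - (\<Sum>x\<in>?F. cnj (u x) * laplacian c v x)"
  have u: "u \<in> dom_energy c"
    using assms(2) by (simp add: class_of_in_energy_space)
  have "class_of v \<in> finite_charge"
    using assms(3) monopole_span_finite_charge by blast
  then have v: "v \<in> dom_energy c" and D: "finite ?D"
    by (auto simp: finite_charge_def class_of_in_energy_space laplacian_class.abs_eq)
  have "has_exhaustion_sum c (\<lambda>x. cnj (u x) * laplacian c v x) ?S"
    unfolding has_exhaustion_sum_def
  proof (intro conjI allI impI exhaustion_exists tendsto_eventually)
    fix G assume "exhaustion c G"
    from exhaustion_eventually_subset[OF this D]
    show "\<forall>\<^sub>F k in sequentially. (\<Sum>x\<in>G k. cnj (u x) * laplacian c v x) = ?S"
      by eventually_elim (auto intro!: sum.mono_neutral_right)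
  qed
  moreover have "has_boundary_sum c (\<lambda>H x. cnj (u x) * normal_derivative c H v x) ?B"
    unfolding has_boundary_sum_def
    using exhaustion_exists boundary_sum_tendsto[OF u v D] by blast
  moreover have "energy_inner c (class_of u) (class_of v) = ?S + ?B"
    if "\<forall>x. infinite {y. adj c x y} \<longrightarrow> laplacian c v x = 0"
  proof -
    have "?F = ?D" using that by blast
    then show ?thesis by (simp add: energy_inner.abs_eq)
  qed
  ultimately show ?thesis by blast
qed

end
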